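(* Let $S$ be an infinite set, let $F$ be a finite set and let $P$ be a polynomial mapping from $\mathcal{F}(S\times F)$ into a commutative group $G$ with $P(\emptyset)=0$. Then for any finite coloring of $G$ there exist $h\in G$ and a nonempty $\gamma\in\mathcal{F}(S)$ such that the set $\{h+P(\gamma\times c):\ c\subseteq F\}$ is monochromatic.
   Context: For a set $W$, $\mathcal{F}(W)$ is the set of finite subsets of $W$ (including $\emptyset$). Polynomial mappings from $\mathcal{F}(W)$ into a commutative semigroup $G$ are defined recursively: a mapping is polynomial of degree $0$ if it is constant; for $d\in\mathbb{N}$, $P:\mathcal{F}(W)\to G$ is polynomial of degree $\le d$ if for every $m\in\mathcal{F}(W)$ there exists a polynomial mapping $D_mP:\mathcal{F}(W\setminus m)\to G$ of degree $\le d-1$ with $P(n\cup m)=P(n)+(D_mP)(n)$ for all $n\in\mathcal{F}(W)$, $n\cap m=\emptyset$. A polynomial mapping is one of degree $\le d$ for some $d$. A finite coloring is a map into $\{1,\dots,r\}$ for some $r$; a set is monochromatic if the coloring is constant on it. *)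

theory Defs
  imports "HOL-Analysis.Abstract_Topology_2"
begin

(* Only the values of P on Fpow W matter: a mapping from F(W) into the semigroup is
   represented by a total function on sets whose values outside Fpow W are ignored. *)
primrec polynomial_le :: "nat \<Rightarrow> 'w set \<Rightarrow> ('w set \<Rightarrow> 'g::ab_semigroup_add) \<Rightarrow> bool" where
  "polynomial_le 0 W P \<longleftrightarrow> (\<exists>a. \<forall>n\<in>Fpow W. P n = a)"
| "polynomial_le (Suc d) W P \<longleftrightarrow>
     (\<forall>m\<in>Fpow W. \<exists>D. polynomial_le d (W - m) D \<and>
        (\<forall>n\<in>Fpow W. n \<inter> m = {} \<longrightarrow> P (n \<union> m) = P n + D n))"

definition polynomial_mapping :: "'w set \<Rightarrow> ('w set \<Rightarrow> 'g::ab_semigroup_add) \<Rightarrow> bool" where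
  "polynomial_mapping W P \<longleftrightarrow> (\<exists>d. polynomial_le d W P)"

end

(* Colour focusing combined with PET induction, as in Walters' proof of the polynomial van der
   Waerden theorem. A finite family of polynomial mappings vanishing at the empty set is grouped
   into classes, two mappings of degree at most e + 1 being close when they differ by one of
   degree at most e. Let L be the leader of a class of minimal degree. Replacing every P by the
   mappings n |-> P(n Un g) - P(g) - L(n), with g in a finite set of possible steps, destroys the
   class of L in favour of classes of smaller degree and keeps the number of all other classes,
   so that the multiset of degrees drops. The statement for the new family, applied to a product
   colouring, moves a point focused in s colours to one focused in s + 1 colours, and this can
   happen only as often as there are colours. The theorem is the case of the family
   g |-> P(g x c), c a subset of F. *)
theory Submission
  imports Defs "HOL-Library.Multiset"
begin

section \<open>Polynomial mappings into an abelian group\<close>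

lemma polynomial_le_subset:
  "polynomial_le d W P \<Longrightarrow> V \<subseteq> W \<Longrightarrow> polynomial_le d V P"
proof (induction d arbitrary: V W P)
  case 0
  then show ?case
    using Fpow_mono by fastforce
next
  case (Suc d)
  show ?case
    unfolding polynomial_le.simps
  proof
    fix m assume "m \<in> Fpow V"
    then have "m \<in> Fpow W"
      using Suc.prems(2) Fpow_mono by blast
    then obtain D where D: "polynomial_le d (W - m) D"
      "\<forall>n\<in>Fpow W. n \<inter> m = {} \<longrightarrow> P (n \<union> m) = P n + D n"
      using Suc.prems(1) by auto
    have "polynomial_le d (V - m) D"
      using Suc.IH[OF D(1)] Suc.prems(2) by blast
    then show "\<exists>D. polynomial_le d (V - m) D \<and>
        (\<forall>n\<in>Fpow V. n \<inter> m = {} \<longrightarrow> P (n \<union> m) = P n + D n)"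
      using D(2) Fpow_mono[OF Suc.prems(2)] by blast
  qed
qed

lemma polynomial_le_cong:
  assumes "\<And>n. n \<in> Fpow W \<Longrightarrow> P n = Q n"
  shows "polynomial_le d W P \<longleftrightarrow> polynomial_le d W Q"
proof (cases d)
  case 0
  then show ?thesis using assms by simp
next
  case (Suc e)
  have "n \<union> m \<in> Fpow W" if "n \<in> Fpow W" "m \<in> Fpow W" for n m
    using that by (auto simp: Fpow_def)
  then show ?thesis
    unfolding Suc polynomial_le.simps using assms by (simp cong: ball_cong)
qed

lemma polynomial_le_const: "polynomial_le d W (\<lambda>_. a :: 'g :: ab_group_add)"
  by (induction d arbitrary: W a) (auto intro: exI[of _ "\<lambda>_. 0"])

lemma polynomial_le_Suc:
  fixes P :: "'w set \<Rightarrow> 'g :: ab_group_add"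
  shows "polynomial_le d W P \<Longrightarrow> polynomial_le (Suc d) W P"
proof (induction d arbitrary: W P)
  case 0
  then obtain a where "\<forall>n\<in>Fpow W. P n = a"
    by auto
  then have "polynomial_le (Suc 0) W P \<longleftrightarrow> polynomial_le (Suc 0) W (\<lambda>_. a)"
    by (intro polynomial_le_cong) auto
  then show ?case
    using polynomial_le_const by blast
next
  case (Suc d)
  show ?case
    unfolding polynomial_le.simps(2)[of "Suc d"]
  proof
    fix m assume "m \<in> Fpow W"
    then obtain D where "polynomial_le d (W - m) D"
      "\<forall>n\<in>Fpow W. n \<inter> m = {} \<longrightarrow> P (n \<union> m) = P n + D n"
      using Suc.prems by auto
    then show "\<exists>D. polynomial_le (Suc d) (W - m) D \<and>
        (\<forall>n\<in>Fpow W. n \<inter> m = {} \<longrightarrow> P (n \<union> m) = P n + D n)"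
      using Suc.IH by blast
  qed
qed

lemma polynomial_le_add:
  fixes P Q :: "'w set \<Rightarrow> 'g :: ab_group_add"
  shows "polynomial_le d W P \<Longrightarrow> polynomial_le d W Q \<Longrightarrow> polynomial_le d W (\<lambda>n. P n + Q n)"
proof (induction d arbitrary: W P Q)
  case 0
  then show ?case by fastforce
next
  case (Suc d)
  show ?case
    unfolding polynomial_le.simps
  proof
    fix m assume m: "m \<in> Fpow W"
    obtain D where D: "polynomial_le d (W - m) D"
      "\<forall>n\<in>Fpow W. n \<inter> m = {} \<longrightarrow> P (n \<union> m) = P n + D n"
      using m Suc.prems(1) by auto
    obtain E where E: "polynomial_le d (W - m) E"
      "\<forall>n\<in>Fpow W. n \<inter> m = {} \<longrightarrow> Q (n \<union> m) = Q n + E n"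
      using m Suc.prems(2) by auto
    show "\<exists>D. polynomial_le d (W - m) D \<and>
        (\<forall>n\<in>Fpow W. n \<inter> m = {} \<longrightarrow> P (n \<union> m) + Q (n \<union> m) = P n + Q n + D n)"
      using Suc.IH[OF D(1) E(1)] D(2) E(2)
      by (intro exI[of _ "\<lambda>n. D n + E n"]) (simp add: algebra_simps)
  qed
qed

lemma polynomial_le_minus:
  fixes P :: "'w set \<Rightarrow> 'g :: ab_group_add"
  shows "polynomial_le d W P \<Longrightarrow> polynomial_le d W (\<lambda>n. - P n)"
proof (induction d arbitrary: W P)
  case 0
  then show ?case by fastforce
next
  case (Suc d)
  show ?case
    unfolding polynomial_le.simps
  proof
    fix m assume m: "m \<in> Fpow W"
    obtain D where D: "polynomial_le d (W - m) D"
      "\<forall>n\<in>Fpow W. n \<inter> m = {} \<longrightarrow> P (n \<union> m) = P n + D n"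
      using m Suc.prems by auto
    show "\<exists>D. polynomial_le d (W - m) D \<and>
        (\<forall>n\<in>Fpow W. n \<inter> m = {} \<longrightarrow> - P (n \<union> m) = - P n + D n)"
      using Suc.IH[OF D(1)] D(2) by (intro exI[of _ "\<lambda>n. - D n"]) simp
  qed
qed

lemma polynomial_le_diff:
  fixes P Q :: "'w set \<Rightarrow> 'g :: ab_group_add"
  assumes "polynomial_le d W P" "polynomial_le d W Q"
  shows "polynomial_le d W (\<lambda>n. P n - Q n)"
  using polynomial_le_add[OF assms(1) polynomial_le_minus[OF assms(2)]] by simp

text \<open>In a group the values of \<open>D\<close> on \<open>Fpow (W - m)\<close> are forced, so
  the witness can be replaced by an explicit difference. Since it is controlled only away from
  \<open>m\<close>, the ground set shrinks at each step of the PET induction.\<close>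

lemma polynomial_le_shift_diff:
  fixes P :: "'w set \<Rightarrow> 'g :: ab_group_add"
  assumes P: "polynomial_le (Suc d) W P" and m: "m \<in> Fpow W" and V: "V \<subseteq> W - m"
  shows "polynomial_le d V (\<lambda>n. P (n \<union> m) - P n)"
proof -
  obtain D where D: "polynomial_le d (W - m) D"
    "\<forall>n\<in>Fpow W. n \<inter> m = {} \<longrightarrow> P (n \<union> m) = P n + D n"
    using P m by auto
  have "P (n \<union> m) - P n = D n" if "n \<in> Fpow V" for n
  proof -
    have "n \<in> Fpow W" "n \<inter> m = {}"
      using that V by (auto simp: Fpow_def)
    then show ?thesis using D(2) by simp
  qed
  then have "polynomial_le d V (\<lambda>n. P (n \<union> m) - P n) \<longleftrightarrow> polynomial_le d V D"
    by (rule polynomial_le_cong)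
  then show ?thesis
    using polynomial_le_subset[OF D(1) V] by simp
qed

text \<open>The map \<open>\<gamma> \<mapsto> \<gamma> \<times> c\<close> preserves disjoint unions,
  so the difference of \<open>P\<close> by \<open>m \<times> c\<close> restricts to a difference by
  \<open>m\<close>. The ground set \<open>W\<close> is arbitrary because
  \<open>W - m \<times> c\<close> need not be a product; it still contains
  \<open>(S - m) \<times> c\<close>.\<close>

lemma polynomial_le_times:
  assumes "finite c"
  shows "polynomial_le d W P \<Longrightarrow> S \<times> c \<subseteq> W \<Longrightarrow> polynomial_le d S (\<lambda>\<gamma>. P (\<gamma> \<times> c))"
proof (induction d arbitrary: W P S)
  case 0
  have "\<gamma> \<times> c \<in> Fpow W" if "\<gamma> \<in> Fpow S" for \<gamma>
    using that 0(2) assms by (auto simp: Fpow_def)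
  then show ?case using 0(1) by auto
next
  case (Suc d)
  have times: "\<gamma> \<times> c \<in> Fpow W" if "\<gamma> \<in> Fpow S" for \<gamma>
    using that Suc.prems(2) assms by (auto simp: Fpow_def)
  show ?case
    unfolding polynomial_le.simps
  proof
    fix m assume m: "m \<in> Fpow S"
    obtain D where D: "polynomial_le d (W - m \<times> c) D"
      "\<forall>n\<in>Fpow W. n \<inter> m \<times> c = {} \<longrightarrow> P (n \<union> m \<times> c) = P n + D n"
      using times[OF m] Suc.prems(1) by auto
    have "polynomial_le d (S - m) (\<lambda>\<gamma>. D (\<gamma> \<times> c))"
      using Suc.prems(2) by (intro Suc.IH[OF D(1)]) auto
    moreover have "P ((n \<union> m) \<times> c) = P (n \<times> c) + D (n \<times> c)"
      if "n \<in> Fpow S" "n \<inter> m = {}" for n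
    proof -
      have "n \<times> c \<inter> m \<times> c = {}" "(n \<union> m) \<times> c = n \<times> c \<union> m \<times> c"
        using that(2) by auto
      then show ?thesis using D(2) times[OF that(1)] by simp
    qed
    ultimately show "\<exists>D. polynomial_le d (S - m) D \<and>
        (\<forall>n\<in>Fpow S. n \<inter> m = {} \<longrightarrow> P ((n \<union> m) \<times> c) = P (n \<times> c) + D n)"
      by blast
  qed
qed

section \<open>Colour focusing\<close>

text \<open>A finitary form of recurrence: \<open>U\<close> and \<open>Y\<close> depend on the
  number of colours but not on the colouring. Focusing needs this, since the product colouring of
  the next stage is built from \<open>U\<close> and \<open>Y\<close> before the point that
  translates \<open>\<chi>\<close> is known.\<close>

definition recurrent_family :: "'w set \<Rightarrow> ('w set \<Rightarrow> 'g :: ab_group_add) set \<Rightarrow> bool" where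
  "recurrent_family W A \<longleftrightarrow>
     (\<forall>r. \<exists>U Y. finite U \<and> U \<subseteq> W \<and> finite Y \<and>
        (\<forall>\<chi> :: 'g \<Rightarrow> nat. range \<chi> \<subseteq> {..<r} \<longrightarrow>
           (\<exists>h\<in>Y. \<exists>\<gamma>. \<gamma> \<subseteq> U \<and> \<gamma> \<noteq> {} \<and> (\<forall>P\<in>A. \<chi> (h + P \<gamma>) = \<chi> h))))"

text \<open>Recurrence is applied to the colouring of \<open>g\<close> by its whole pattern
  \<open>z \<mapsto> \<chi> (g + z)\<close> on \<open>Z\<close>, numbered by \<open>e\<close>. The
  number of patterns depends only on \<open>Z\<close> and \<open>r\<close>, so \<open>U\<close> and
  \<open>Y\<close> remain uniform in \<open>\<chi>\<close>.\<close>

lemma recurrent_family_product: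
  fixes A :: "('w set \<Rightarrow> 'g :: ab_group_add) set"
  assumes A: "recurrent_family W A" and Z: "finite Z"
  shows "\<exists>U Y. finite U \<and> U \<subseteq> W \<and> finite Y \<and>
    (\<forall>\<chi> :: 'g \<Rightarrow> nat. range \<chi> \<subseteq> {..<r} \<longrightarrow>
       (\<exists>h\<in>Y. \<exists>\<gamma>. \<gamma> \<subseteq> U \<and> \<gamma> \<noteq> {} \<and> (\<forall>P\<in>A. \<forall>z\<in>Z. \<chi> (h + P \<gamma> + z) = \<chi> (h + z))))"
proof -
  let ?V = "Z \<rightarrow>\<^sub>E {..<r}"
  have "finite ?V"
    using Z by (simp add: finite_PiE)
  then obtain e where e: "bij_betw e ?V {0..<card ?V}"
    using ex_bij_betw_finite_nat by blast
  obtain U Y where UY: "finite U" "U \<subseteq> W" "finite Y"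
    and rec: "\<And>\<chi> :: 'g \<Rightarrow> nat. range \<chi> \<subseteq> {..<card ?V} \<Longrightarrow>
      \<exists>h\<in>Y. \<exists>\<gamma>. \<gamma> \<subseteq> U \<and> \<gamma> \<noteq> {} \<and> (\<forall>P\<in>A. \<chi> (h + P \<gamma>) = \<chi> h)"
    using A unfolding recurrent_family_def by metis
  have "\<exists>h\<in>Y. \<exists>\<gamma>. \<gamma> \<subseteq> U \<and> \<gamma> \<noteq> {} \<and> (\<forall>P\<in>A. \<forall>z\<in>Z. \<chi> (h + P \<gamma> + z) = \<chi> (h + z))"
    if \<chi>: "range \<chi> \<subseteq> {..<r}" for \<chi> :: "'g \<Rightarrow> nat"
  proof -
    define v where "v g = restrict (\<lambda>z. \<chi> (g + z)) Z" for g
    have v: "v g \<in> ?V" for g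
      using \<chi> by (auto simp: v_def)
    have "range (\<lambda>g. e (v g)) \<subseteq> {..<card ?V}"
      using bij_betwE[OF e] v by fastforce
    from rec[OF this] obtain h \<gamma> where h: "h \<in> Y" "\<gamma> \<subseteq> U" "\<gamma> \<noteq> {}"
      and eq: "\<And>P. P \<in> A \<Longrightarrow> e (v (h + P \<gamma>)) = e (v h)"
      by blast
    have "v (h + P \<gamma>) = v h" if "P \<in> A" for P
      using inj_onD[OF bij_betw_imp_inj_on[OF e] eq[OF that] v v] .
    then have "\<chi> (h + P \<gamma> + z) = \<chi> (h + z)" if "P \<in> A" "z \<in> Z" for P z
      using that unfolding v_def by (metis restrict_apply')
    then show ?thesis using h by blast
  qed
  then show ?thesis using UY by blast
qed

text \<open>The shape is dictated by the identity \<open>h + (P (n \<union> \<gamma>) - P \<gamma> -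
  L n) + (a + P \<gamma>) = (h + a - L n) + P (n \<union> \<gamma>)\<close>: recurrence of the new
  family compares the points around \<open>h + a\<close> with those around the new base point
  \<open>h + a - L n\<close>.\<close>

definition focus_step ::
  "('w set \<Rightarrow> 'g :: ab_group_add) set \<Rightarrow> ('w set \<Rightarrow> 'g) \<Rightarrow> 'w set \<Rightarrow> ('w set \<Rightarrow> 'g) set" where
  "focus_step A L U = (\<lambda>(P, \<gamma>) n. P (n \<union> \<gamma>) - P \<gamma> - L n) ` (A \<times> Pow U)"

lemma recurrent_family_if_focus_step:
  fixes A :: "('w set \<Rightarrow> 'g :: ab_group_add) set"
  assumes A: "finite A" "\<And>P. P \<in> A \<Longrightarrow> P {} = 0"
    and step: "\<And>U. finite U \<Longrightarrow> U \<subseteq> W \<Longrightarrow> recurrent_family (W - U) (focus_step A L U)"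
  shows "recurrent_family W A"
proof -
  \<comment> \<open>The invariant: either recurrence already occurs, or some \<open>h\<close> is
    focused in \<open>s\<close> distinct colours, each attained by the whole family at a nonempty
    \<gamma>.\<close>
  have focus: "\<exists>U Y. finite U \<and> U \<subseteq> W \<and> finite Y \<and>
    (\<forall>\<chi> :: 'g \<Rightarrow> nat. range \<chi> \<subseteq> {..<r} \<longrightarrow>
       (\<exists>h\<in>Y. \<exists>\<gamma>. \<gamma> \<subseteq> U \<and> \<gamma> \<noteq> {} \<and> (\<forall>P\<in>A. \<chi> (h + P \<gamma>) = \<chi> h)) \<or>
       (\<exists>h\<in>Y. \<exists>C. C \<subseteq> {..<r} \<and> card C = s \<and>
          (\<forall>c\<in>C. \<exists>\<gamma>. \<gamma> \<subseteq> U \<and> \<gamma> \<noteq> {} \<and> (\<forall>P\<in>A. \<chi> (h + P \<gamma>) = c))))" for r s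
  proof (induction s)
    case 0
    show ?case
      by (intro exI[of _ "{}"] exI[of _ "{0}"]) auto
  next
    case (Suc s)
    define recs where "recs U Y \<chi> \<longleftrightarrow>
      (\<exists>h\<in>Y. \<exists>\<gamma>. \<gamma> \<subseteq> U \<and> \<gamma> \<noteq> {} \<and> (\<forall>P\<in>A. \<chi> (h + P \<gamma>) = \<chi> h))" for U Y and \<chi> :: "'g \<Rightarrow> nat"
    define focused where "focused U Y s \<chi> \<longleftrightarrow>
      (\<exists>h\<in>Y. \<exists>C. C \<subseteq> {..<r} \<and> card C = s \<and>
          (\<forall>c\<in>C. \<exists>\<gamma>. \<gamma> \<subseteq> U \<and> \<gamma> \<noteq> {} \<and> (\<forall>P\<in>A. \<chi> (h + P \<gamma>) = c)))" for U Y s and \<chi> :: "'g \<Rightarrow> nat"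
    obtain U Y where UY: "finite U" "U \<subseteq> W" "finite Y"
      and IH: "\<And>\<chi>. range \<chi> \<subseteq> {..<r} \<Longrightarrow> recs U Y \<chi> \<or> focused U Y s \<chi>"
      using Suc.IH unfolding recs_def focused_def by metis
    \<comment> \<open>All points that the previous stage can reach; their colours must survive the
      shift by the new family.\<close>
    define Z where "Z = (\<lambda>(y, P, \<gamma>). y + P \<gamma>) ` (Y \<times> A \<times> Pow U)"
    have "finite Z"
      unfolding Z_def using UY A by simp
    from recurrent_family_product[OF step[OF UY(1,2)] this, of r]
    obtain U' Y' where UY': "finite U'" "U' \<subseteq> W - U" "finite Y'"
      and prod: "\<And>\<chi> :: 'g \<Rightarrow> nat. range \<chi> \<subseteq> {..<r} \<Longrightarrow>
       \<exists>h\<in>Y'. \<exists>\<gamma>. \<gamma> \<subseteq> U' \<and> \<gamma> \<noteq> {} \<and>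
         (\<forall>P\<in>focus_step A L U. \<forall>z\<in>Z. \<chi> (h + P \<gamma> + z) = \<chi> (h + z))"
      by blast
    define U2 where "U2 = U \<union> U'"
    \<comment> \<open>The points \<open>h + a\<close> serve when recurrence is found, the points
      \<open>h + a - L n\<close> when one more colour is gained.\<close>
    define Y2 where "Y2 = (\<lambda>(h, a). h + a) ` (Y' \<times> Y)
      \<union> (\<lambda>(h, a, n). h + a - L n) ` (Y' \<times> Y \<times> Pow U')"
    have "finite U2" "U2 \<subseteq> W" "finite Y2"
      using UY UY' by (auto simp: U2_def Y2_def)
    moreover have "recs U2 Y2 \<chi> \<or> focused U2 Y2 (Suc s) \<chi>"
      if \<chi>: "range \<chi> \<subseteq> {..<r}" for \<chi>
    proof -
      obtain h n where h: "h \<in> Y'" and n: "n \<subseteq> U'" "n \<noteq> {}"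
        and same: "\<And>P z. P \<in> focus_step A L U \<Longrightarrow> z \<in> Z \<Longrightarrow> \<chi> (h + P n + z) = \<chi> (h + z)"
        using prod[OF \<chi>] by blast
      have moved: "\<chi> (h + a - L n + P (n \<union> \<gamma>)) = \<chi> (h + a + P \<gamma>)"
        if "a \<in> Y" "P \<in> A" "\<gamma> \<subseteq> U" for a P \<gamma>
      proof -
        have "(\<lambda>n. P (n \<union> \<gamma>) - P \<gamma> - L n) \<in> focus_step A L U"
          using that unfolding focus_step_def by force
        moreover have "a + P \<gamma> \<in> Z"
          using that unfolding Z_def by force
        ultimately show ?thesis
          using same[of "\<lambda>n. P (n \<union> \<gamma>) - P \<gamma> - L n" "a + P \<gamma>"] by (simp add: algebra_simps)
      qed
      \<comment> \<open>The previous stage is applied to the colouring translated by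
        \<open>h\<close>, which is possible because \<open>U\<close> and \<open>Y\<close> were fixed
        for all colourings.\<close>
      have "range (\<lambda>g. \<chi> (h + g)) \<subseteq> {..<r}"
        using \<chi> by blast
      from IH[OF this] show ?thesis
      proof
        assume "recs U Y (\<lambda>g. \<chi> (h + g))"
        then obtain a \<gamma> where a: "a \<in> Y" "\<gamma> \<subseteq> U" "\<gamma> \<noteq> {}"
          "\<forall>P\<in>A. \<chi> (h + (a + P \<gamma>)) = \<chi> (h + a)"
          unfolding recs_def by blast
        have "h + a \<in> Y2"
          using h a(1) unfolding Y2_def by force
        then have "recs U2 Y2 \<chi>"
          unfolding recs_def U2_def using a by (metis add.assoc le_supI1)
        then show ?thesis ..
      next
        assume "focused U Y s (\<lambda>g. \<chi> (h + g))"
        then obtain a C where a: "a \<in> Y" and C: "C \<subseteq> {..<r}" "card C = s"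
          and foc: "\<And>c. c \<in> C \<Longrightarrow> \<exists>\<gamma>. \<gamma> \<subseteq> U \<and> \<gamma> \<noteq> {} \<and> (\<forall>P\<in>A. \<chi> (h + (a + P \<gamma>)) = c)"
          unfolding focused_def by blast
        show ?thesis
        \<comment> \<open>If the colour of the focus \<open>h + a\<close> is one of the focused
          colours, the corresponding \<gamma> gives recurrence; otherwise it becomes the additional
          colour.\<close>
        proof (cases "\<chi> (h + a) \<in> C")
          case True
          then obtain \<gamma> where \<gamma>: "\<gamma> \<subseteq> U" "\<gamma> \<noteq> {}" "\<forall>P\<in>A. \<chi> (h + (a + P \<gamma>)) = \<chi> (h + a)"
            using foc by blast
          have "h + a \<in> Y2"
            using h a unfolding Y2_def by force
          then have "recs U2 Y2 \<chi>"
            unfolding recs_def U2_def using \<gamma> by (metis add.assoc le_supI1)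
          then show ?thesis ..
        next
          case False
          \<comment> \<open>At the new focus the set \<open>n\<close> realises the colour of
            \<open>h + a\<close>, which is the case \<open>\<gamma> = {}\<close> of
            \<open>moved\<close>; an old colour realised by \<gamma> is now realised by
            \<open>n \<union> \<gamma>\<close>.\<close>
          have "\<exists>\<gamma>. \<gamma> \<subseteq> U2 \<and> \<gamma> \<noteq> {} \<and> (\<forall>P\<in>A. \<chi> (h + a - L n + P \<gamma>) = c)"
            if c: "c \<in> insert (\<chi> (h + a)) C" for c
          proof (cases "c = \<chi> (h + a)")
            case True
            have "\<chi> (h + a - L n + P n) = c" if "P \<in> A" for P
              using moved[OF a that, of "{}"] A(2)[OF that] True by simp
            then show ?thesis
              using n unfolding U2_def by blast
          next
            case False
            then obtain \<gamma> where \<gamma>: "\<gamma> \<subseteq> U" "\<gamma> \<noteq> {}" "\<forall>P\<in>A. \<chi> (h + (a + P \<gamma>)) = c"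
              using foc c by blast
            then show ?thesis
              using moved[OF a _ \<gamma>(1)] n unfolding U2_def
              by (intro exI[of _ "n \<union> \<gamma>"]) (auto simp: add.assoc)
          qed
          moreover have "insert (\<chi> (h + a)) C \<subseteq> {..<r}"
            using C \<chi> by blast
          moreover have "card (insert (\<chi> (h + a)) C) = Suc s"
            using C False finite_subset[OF C(1)] by simp
          moreover have "h + a - L n \<in> Y2"
            using h a n unfolding Y2_def by force
          ultimately have "focused U2 Y2 (Suc s) \<chi>"
            unfolding focused_def by blast
          then show ?thesis ..
        qed
      qed
    qed
    ultimately show ?case
      unfolding recs_def focused_def by blast
  qed
  \<comment> \<open>Among \<open>r\<close> colours no point is focused in \<open>r + 1\<close>, so
    at \<open>s = Suc r\<close> only recurrence is left.\<close>
  have few: "C \<subseteq> {..<r} \<and> card C = Suc r \<and> Q \<longleftrightarrow> False" for r Q and C :: "nat set"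
    using card_mono[of "{..<r}" C] by auto
  show ?thesis
    unfolding recurrent_family_def
  proof
    fix r
    show "\<exists>U Y. finite U \<and> U \<subseteq> W \<and> finite Y \<and>
        (\<forall>\<chi> :: 'g \<Rightarrow> nat. range \<chi> \<subseteq> {..<r} \<longrightarrow>
           (\<exists>h\<in>Y. \<exists>\<gamma>. \<gamma> \<subseteq> U \<and> \<gamma> \<noteq> {} \<and> (\<forall>P\<in>A. \<chi> (h + P \<gamma>) = \<chi> h)))"
      using focus[of r "Suc r"] unfolding few by simp
  qed
qed

section \<open>PET induction\<close>

text \<open>The entry \<open>(e, L)\<close> stands for the class of the mappings of degree at most \<open>e + 1\<close> that
  differ from \<open>L\<close> by one of degree at most \<open>e\<close>. The number \<open>e\<close> is only a bound on degrees, since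
  actual degrees can drop when \<open>W\<close> shrinks.\<close>

definition class_leaders ::
  "'w set \<Rightarrow> ('w set \<Rightarrow> 'g :: ab_group_add) set \<Rightarrow> (nat \<times> ('w set \<Rightarrow> 'g)) list \<Rightarrow> bool" where
  "class_leaders W A ls \<longleftrightarrow>
     (\<forall>(e, L) \<in> set ls. polynomial_le (Suc e) W L \<and> L {} = 0) \<and>
     (\<forall>P\<in>A. \<exists>(e, L) \<in> set ls. polynomial_le e W (\<lambda>n. P n - L n))"

definition nonzero_on :: "'w set \<Rightarrow> ('w set \<Rightarrow> 'g :: zero) set \<Rightarrow> ('w set \<Rightarrow> 'g) set" where
  "nonzero_on W A = {P \<in> A. \<exists>n\<in>Fpow W. P n \<noteq> 0}"

lemma recurrent_family_nonzero_on:
  assumes "recurrent_family W (nonzero_on W A)"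
  shows "recurrent_family W A"
proof -
  have all: "\<chi> (h + P \<gamma>) = \<chi> h"
    if "finite U" "U \<subseteq> W" "\<gamma> \<subseteq> U" "P \<in> A" "\<forall>P\<in>nonzero_on W A. \<chi> (h + P \<gamma>) = \<chi> h"
    for \<chi> :: "'b \<Rightarrow> nat" and h U \<gamma> P
  proof (cases "P \<in> nonzero_on W A")
    case False
    have "\<gamma> \<in> Fpow W"
      using that(1-3) finite_subset unfolding Fpow_def by blast
    then show ?thesis
      using False that(4) unfolding nonzero_on_def by auto
  qed (use that in blast)
  show ?thesis
    unfolding recurrent_family_def
  proof
    fix r
    obtain U Y where UY: "finite U" "U \<subseteq> W" "finite Y"
      and rec: "\<And>\<chi> :: 'b \<Rightarrow> nat. range \<chi> \<subseteq> {..<r} \<Longrightarrow>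
        \<exists>h\<in>Y. \<exists>\<gamma>. \<gamma> \<subseteq> U \<and> \<gamma> \<noteq> {} \<and> (\<forall>P\<in>nonzero_on W A. \<chi> (h + P \<gamma>) = \<chi> h)"
      using assms unfolding recurrent_family_def by metis
    have "\<exists>h\<in>Y. \<exists>\<gamma>. \<gamma> \<subseteq> U \<and> \<gamma> \<noteq> {} \<and> (\<forall>P\<in>A. \<chi> (h + P \<gamma>) = \<chi> h)"
      if "range \<chi> \<subseteq> {..<r}" for \<chi> :: "'b \<Rightarrow> nat"
      using rec[OF that] all[OF UY(1,2)] by blast
    then show "\<exists>U Y. finite U \<and> U \<subseteq> W \<and> finite Y \<and>
        (\<forall>\<chi> :: 'b \<Rightarrow> nat. range \<chi> \<subseteq> {..<r} \<longrightarrow>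
           (\<exists>h\<in>Y. \<exists>\<gamma>. \<gamma> \<subseteq> U \<and> \<gamma> \<noteq> {} \<and> (\<forall>P\<in>A. \<chi> (h + P \<gamma>) = \<chi> h)))"
      using UY by blast
  qed
qed

text \<open>Mappings that vanish on \<open>Fpow W\<close> have to be discarded before each step: such a mapping would
  contribute \<open>- L\<close>, which is again of degree \<open>e + 1\<close>.\<close>

lemma class_leaders_focus_step:
  fixes A :: "('w set \<Rightarrow> 'g :: ab_group_add) set"
  assumes A: "finite A" "\<And>P. P \<in> A \<Longrightarrow> P {} = 0" and U: "finite U" "U \<subseteq> W"
    and ls: "class_leaders W A ls"
    and L: "(e, L) \<in> set ls" and min: "\<And>f M. (f, M) \<in> set ls \<Longrightarrow> e \<le> f"
  shows "\<exists>ls'. class_leaders (W - U) (nonzero_on (W - U) (focus_step A L U)) ls' \<and>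
    (mset (map fst ls'), mset (map fst ls)) \<in> mult1 less_than"
proof -
  define B where "B = focus_step A L U"
  \<comment> \<open>Each of these mappings will lead a class of its own with bound
    \<open>e - 1\<close>. The condition \<open>e > 0\<close> keeps the truncated subtraction from
    returning \<open>e\<close> itself.\<close>
  define low where "low = {Q \<in> B. e > 0 \<and> polynomial_le e (W - U) Q}"
  have "finite low"
    unfolding low_def B_def focus_step_def using A U by simp
  then obtain bs where bs: "set bs = low"
    using finite_list by blast
  define ls' where "ls' = map (\<lambda>(f, M). (f, \<lambda>n. M n - L n)) (remove1 (e, L) ls)
    @ map (\<lambda>Q. (e - 1, Q)) bs"
  have leader: "polynomial_le (Suc f) V M" "M {} = 0" if "(f, M) \<in> set ls" "V \<subseteq> W" for f M V
    using ls that polynomial_le_subset unfolding class_leaders_def by blast+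
  \<comment> \<open>By minimality of \<open>e\<close>, subtracting \<open>L\<close> from another
    leader of bound \<open>f\<close> keeps the degree at most \<open>f + 1\<close>.\<close>
  have L_le: "polynomial_le (Suc f) V L" if f: "e \<le> f" and V: "V \<subseteq> W" for f V
    using f by (induction f rule: dec_induct)
      (use leader(1)[OF L V] in \<open>auto intro: polynomial_le_Suc simp del: polynomial_le.simps\<close>)
  have L0: "L {} = 0"
    using leader(2)[OF L order_refl] .
  have B0: "Q {} = 0" if "Q \<in> B" for Q
    using that L0 unfolding B_def focus_step_def by auto
  \<comment> \<open>The mapping is
    \<open>(P (n \<union> \<gamma>) - P n) + (P n - M n) - P \<gamma>\<close>. Being close to
    \<open>M\<close>, \<open>P\<close> has degree at most \<open>f + 1\<close>, so the first
    difference has degree at most \<open>f\<close>, as has the second.\<close>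
  have shifted: "polynomial_le f (W - U) (\<lambda>n. P (n \<union> \<gamma>) - P \<gamma> - M n)"
    if "(f, M) \<in> set ls" "P \<in> A" "\<gamma> \<subseteq> U" "polynomial_le f W (\<lambda>n. P n - M n)" for f M P \<gamma>
  proof -
    have \<gamma>: "\<gamma> \<in> Fpow W"
      using that(3) U finite_subset unfolding Fpow_def by blast
    have "polynomial_le (Suc f) W (\<lambda>n. (P n - M n) + M n)"
      using that by (intro polynomial_le_add polynomial_le_Suc leader(1)) auto
    then have "polynomial_le (Suc f) W P"
      by simp
    then have "polynomial_le f (W - U) (\<lambda>n. P (n \<union> \<gamma>) - P n)"
      using that(3) by (intro polynomial_le_shift_diff[OF _ \<gamma>]) auto
    moreover have "polynomial_le f (W - U) (\<lambda>n. P n - M n)"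
      using polynomial_le_subset[OF that(4)] by blast
    ultimately have "polynomial_le f (W - U)
        (\<lambda>n. ((P (n \<union> \<gamma>) - P n) + (P n - M n)) - P \<gamma>)"
      by (rule polynomial_le_diff[OF polynomial_le_add polynomial_le_const])
    then show ?thesis
      by (simp add: algebra_simps)
  qed
  have covered: "\<exists>(f, M) \<in> set ls'. polynomial_le f (W - U) (\<lambda>n. Q n - M n)"
    if Q: "Q \<in> nonzero_on (W - U) B" for Q
  proof -
    have "Q \<in> B"
      using Q unfolding nonzero_on_def by blast
    then obtain P \<gamma> where P: "P \<in> A" "\<gamma> \<subseteq> U" and Q_eq: "Q = (\<lambda>n. P (n \<union> \<gamma>) - P \<gamma> - L n)"
      unfolding B_def focus_step_def by auto
    obtain f M where M: "(f, M) \<in> set ls" "polynomial_le f W (\<lambda>n. P n - M n)"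
      using ls P(1) unfolding class_leaders_def by blast
    show ?thesis
    proof (cases "(f, M) = (e, L)")
      case True
      then have Q_le: "polynomial_le e (W - U) Q"
        using shifted[OF M(1) P M(2)] unfolding Q_eq by simp
      \<comment> \<open>For \<open>e = 0\<close> the mapping \<open>Q\<close> would be constant and
        zero at the empty set, and such mappings have been discarded. The class of \<open>L\<close>
        then disappears without replacement.\<close>
      have "e > 0"
      proof (rule ccontr)
        assume "\<not> e > 0"
        then obtain a where a: "\<forall>n\<in>Fpow (W - U). Q n = a"
          using Q_le by auto
        have "{} \<in> Fpow (W - U)"
          by (simp add: Fpow_def)
        then have "a = 0"
          using a B0[OF \<open>Q \<in> B\<close>] by metis
        then show False
          using a Q unfolding nonzero_on_def by auto
      qed
      then have "(e - 1, Q) \<in> set ls'"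
        using \<open>Q \<in> B\<close> Q_le bs unfolding ls'_def low_def by auto
      moreover have "polynomial_le (e - 1) (W - U) (\<lambda>n. Q n - Q n)"
        using polynomial_le_const[of "e - 1" _ 0] by simp
      ultimately show ?thesis by blast
    next
      case False
      then have "(f, M) \<in> set (remove1 (e, L) ls)"
        using M(1) by simp
      then have "(f, \<lambda>n. M n - L n) \<in> set ls'"
        unfolding ls'_def by force
      moreover have "polynomial_le f (W - U) (\<lambda>n. Q n - (M n - L n))"
        using shifted[OF M(1) P M(2)] unfolding Q_eq by (simp add: algebra_simps)
      ultimately show ?thesis
        by (intro bexI[of _ "(f, \<lambda>n. M n - L n)"]) simp_all
    qed
  qed
  have leader': "polynomial_le (Suc f) (W - U) M \<and> M {} = 0"
    if fM: "(f, M) \<in> set ls'" for f M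
  proof -
    consider (high) N where "(f, N) \<in> set (remove1 (e, L) ls)" "M = (\<lambda>n. N n - L n)"
      | (low) "M \<in> low" "f = e - 1"
      using fM bs unfolding ls'_def by auto
    then show ?thesis
    proof cases
      case high
      then have N: "(f, N) \<in> set ls"
        using set_remove1_subset by fastforce
      have "polynomial_le (Suc f) (W - U) M"
        unfolding high(2) by (intro polynomial_le_diff leader(1)[OF N] L_le[OF min[OF N]]) auto
      then show ?thesis
        using high(2) leader(2)[OF N order_refl] L0 by simp
    next
      case low
      then show ?thesis
        using B0 unfolding low_def by simp
    qed
  qed
  have "class_leaders (W - U) (nonzero_on (W - U) B) ls'"
    unfolding class_leaders_def using leader' covered by blast
  moreover have "(mset (map fst ls'), mset (map fst ls)) \<in> mult1 less_than"
  proof (rule mult1I)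
    have "mset ls = add_mset (e, L) (mset (remove1 (e, L) ls))"
      using L by simp
    then show "mset (map fst ls) = add_mset e (mset (map fst (remove1 (e, L) ls)))"
      by (metis fst_conv image_mset_add_mset mset_map)
    show "mset (map fst ls') = mset (map fst (remove1 (e, L) ls)) + mset (map (\<lambda>_. e - 1) bs)"
      unfolding ls'_def by (simp add: comp_def case_prod_beta)
    \<comment> \<open>A copy of \<open>e - 1\<close> is added only if \<open>low\<close> is
      nonempty, hence only if \<open>e > 0\<close>.\<close>
    show "(b, e) \<in> less_than" if "b \<in># mset (map (\<lambda>_. e - 1) bs)" for b
      using that bs unfolding low_def by auto
  qed
  ultimately show ?thesis
    unfolding B_def by blast
qed

text \<open>Well-founded induction on the multiset of bounds, with \<open>W\<close> generalised
  because every step removes a finite set from it. Infinitude is the form of nonemptiness that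
  survives these removals.\<close>

lemma recurrent_family_if_class_leaders:
  fixes A :: "('w set \<Rightarrow> 'g :: ab_group_add) set"
  assumes "infinite W" "finite A" "\<And>P. P \<in> A \<Longrightarrow> P {} = 0" "class_leaders W A ls"
  shows "recurrent_family W A"
  using assms
proof (induction "mset (map fst ls)" arbitrary: W A ls rule: wf_induct_rule[OF wf_mult1[OF wf_less_than]])
  case (1 ls W A)
  show ?case
  proof (cases "ls = []")
    case True
    then have "A = {}"
      using "1.prems"(4) unfolding class_leaders_def by auto
    \<comment> \<open>With no classes the family is empty, and any nonempty set of parameters
      serves.\<close>
    moreover obtain x where "x \<in> W"
      using \<open>infinite W\<close> by fastforce
    ultimately show ?thesis
      unfolding recurrent_family_def
      by (intro allI exI[of _ "{x}"] exI[of _ "{0}"]) auto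
  next
    case False
    then obtain e L where L: "(e, L) \<in> set ls" "\<And>f M. (f, M) \<in> set ls \<Longrightarrow> e \<le> f"
      using ex_min_if_finite[of "fst ` set ls"] by (fastforce simp: not_less)
    show ?thesis
    proof (rule recurrent_family_if_focus_step[where L = L])
      fix U assume U: "finite U" "U \<subseteq> W"
      let ?B = "nonzero_on (W - U) (focus_step A L U)"
      obtain ls' where ls': "class_leaders (W - U) ?B ls'"
        "(mset (map fst ls'), mset (map fst ls)) \<in> mult1 less_than"
        using class_leaders_focus_step[of A U W ls e L] "1.prems"(2-4) U L by blast
      have "L {} = 0"
        using "1.prems"(4) L(1) unfolding class_leaders_def by blast
      then have "Q {} = 0" if "Q \<in> ?B" for Q
        using that unfolding nonzero_on_def focus_step_def by auto
      moreover have "finite ?B"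
        unfolding nonzero_on_def focus_step_def using U(1) "1.prems"(2) by simp
      moreover have "infinite (W - U)"
        using "1.prems"(1) U(1) by simp
      ultimately have "recurrent_family (W - U) ?B"
        using "1.hyps"[OF ls'(2)] ls'(1) by blast
      then show "recurrent_family (W - U) (focus_step A L U)"
        by (rule recurrent_family_nonzero_on)
    qed (use "1.prems" in auto)
  qed
qed

text \<open>To start the induction, every mapping leads its own class, from which it differs by
  zero.\<close>

lemma recurrent_family_polynomial:
  fixes A :: "('w set \<Rightarrow> 'g :: ab_group_add) set"
  assumes "infinite W" "finite A" "\<And>P. P \<in> A \<Longrightarrow> P {} = 0 \<and> polynomial_le d W P"
  shows "recurrent_family W A"
proof -
  obtain As where As: "set As = A"
    using finite_list[OF assms(2)] by blast
  have "class_leaders W A (map (Pair d) As)"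
    unfolding class_leaders_def
  proof (intro conjI ballI)
    fix x assume "x \<in> set (map (Pair d) As)"
    then show "case x of (e, L) \<Rightarrow> polynomial_le (Suc e) W L \<and> L {} = 0"
      using As assms(3) by (auto intro: polynomial_le_Suc simp del: polynomial_le.simps)
  next
    fix P assume "P \<in> A"
    then have "(d, P) \<in> set (map (Pair d) As)"
      using As by simp
    moreover have "polynomial_le d W (\<lambda>n. P n - P n)"
      using polynomial_le_const[of d W 0] by simp
    ultimately show "\<exists>(e, L) \<in> set (map (Pair d) As). polynomial_le e W (\<lambda>n. P n - L n)"
      by blast
  qed
  then show ?thesis
    using recurrent_family_if_class_leaders assms by blast
qed

theorem theorem8p6:
  fixes S :: "'s set" and F :: "'f set"
    and P :: "('s \<times> 'f) set \<Rightarrow> 'g::ab_group_add"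
    and r :: nat and \<chi> :: "'g \<Rightarrow> nat"
  assumes "infinite S" and "finite F"
    and "polynomial_mapping (S \<times> F) P" and "P {} = 0"
    and "\<chi> ` UNIV \<subseteq> {1..r}"
  shows "\<exists>h. \<exists>\<gamma>\<in>Fpow S. \<gamma> \<noteq> {} \<and> \<chi> constant_on {h + P (\<gamma> \<times> c) | c. c \<subseteq> F}"
proof -
  obtain d where d: "polynomial_le d (S \<times> F) P"
    using assms(3) unfolding polynomial_mapping_def by blast
  define A where "A = (\<lambda>c \<gamma>. P (\<gamma> \<times> c)) ` Pow F"
  have "recurrent_family S A"
  proof (rule recurrent_family_polynomial[OF assms(1)])
    show "finite A"
      unfolding A_def using assms(2) by simp
    fix Q assume "Q \<in> A"
    then obtain c where c: "c \<subseteq> F" "Q = (\<lambda>\<gamma>. P (\<gamma> \<times> c))"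
      unfolding A_def by blast
    have "finite c" "S \<times> c \<subseteq> S \<times> F"
      using c(1) assms(2) finite_subset by auto
    then show "Q {} = 0 \<and> polynomial_le d S Q"
      using polynomial_le_times[OF _ d] c(2) assms(4) by simp
  qed
  then obtain U Y where U: "finite U" "U \<subseteq> S"
    and rec: "\<And>\<chi> :: 'g \<Rightarrow> nat. range \<chi> \<subseteq> {..<Suc r} \<Longrightarrow>
      \<exists>h\<in>Y. \<exists>\<gamma>. \<gamma> \<subseteq> U \<and> \<gamma> \<noteq> {} \<and> (\<forall>Q\<in>A. \<chi> (h + Q \<gamma>) = \<chi> h)"
    unfolding recurrent_family_def by metis
  have "range \<chi> \<subseteq> {..<Suc r}"
    using assms(5) by fastforce
  from rec[OF this] obtain h \<gamma> where \<gamma>: "\<gamma> \<subseteq> U" "\<gamma> \<noteq> {}"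
    and eq: "\<forall>Q\<in>A. \<chi> (h + Q \<gamma>) = \<chi> h"
    by blast
  have "\<gamma> \<in> Fpow S"
    using \<gamma>(1) U finite_subset unfolding Fpow_def by blast
  moreover have "\<chi> constant_on {h + P (\<gamma> \<times> c) | c. c \<subseteq> F}"
    \<comment> \<open>The common colour is that of \<open>h\<close>.\<close>
    unfolding constant_on_def using eq by (auto simp: A_def)
  ultimately show ?thesis
    using \<gamma>(2) by blast
qed

end
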